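(* Let $N_g\ge1$, let $H,S\in\mathbb R^{3N_g\times3N_g}$ satisfy $H=H^T\succ0$ and $S^T=-S$, and let $\bm m_1,\dots,\bm m_{N_g}\in\mathbb R^3$ all be nonzero. Let $B\in\mathbb R^{N_g\times3N_g}$ be the block diagonal matrix with $1\times3$ diagonal blocks $B_i=\bm m_i^T$. Then $B$ has full row rank and $$BB^T=\operatorname{diag}\bigl(\|\bm m_1\|_2^2,\ldots,\|\bm m_{N_g}\|_2^2\bigr),\qquad \sigma_{\min}(B)=\min_i\|\bm m_i\|_2 .$$ In particular, if $\|\bm m_i\|_2=1$ for all $i$, the discrete constraint has inf-sup constant one, i.e. $\inf_{q\ne0}\sup_{v\ne0}\frac{q^TBv}{\|q\|_2\|v\|_2}=1$ (over $q\in\mathbb R^{N_g}$, $v\in\mathbb R^{3N_g}$). The matrix $$\mathcal A=\begin{bmatrix}H+S&B^T\\-B&0\end{bmatrix}$$ is nonsingular. Moreover, for every $\lambda>0$, both $\mathcal H+\lambda\mathcal I$ and $\mathcal S+\lambda\mathcal I$ are nonsingular, where $$\mathcal H=\begin{bmatrix}H&0\\0&0\end{bmatrix},\qquad \mathcal S=\begin{bmatrix}S&B^T\\-B&0\end{bmatrix}.$$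
   Context: $\sigma_{\min}(B)$ denotes the smallest of the $N_g$ singular values of $B$ (equivalently, the square root of the smallest eigenvalue of $BB^T$). $\mathcal I$ is the $4N_g\times4N_g$ identity matrix. *)

theory Defs
  imports "HOL-Analysis.Analysis"
begin

text \<open>
  With \<open>N = CARD('n)\<close>, vectors of length \<open>3 N\<close> are indexed by \<open>'n \<times> 3\<close>, where \<open>(i, k)\<close>
  is the \<open>k\<close>-th component in the \<open>i\<close>-th group of three, and vectors of length \<open>4 N\<close> by
  \<open>('n \<times> 3) + 'n\<close>. Finite types are nonempty, so \<open>N \<ge> 1\<close>. A matrix type
  \<open>real^'c^'r\<close> has rows indexed by \<open>'r\<close> and columns by \<open>'c\<close>.
\<close>

definition diagonal_matrix :: "('n \<Rightarrow> real) \<Rightarrow> real^'n^'n" where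
  "diagonal_matrix d = (\<chi> i j. if i = j then d i else 0)"

text \<open>The block diagonal matrix whose \<open>i\<close>-th diagonal block is the row \<open>(m i)\<^sup>T\<close>.\<close>

definition block_diag_rows :: "('n \<Rightarrow> real^'k) \<Rightarrow> real^('n \<times> 'k)^'n" where
  "block_diag_rows m = (\<chi> i p. if fst p = i then m i $ snd p else 0)"

text \<open>\<open>block_matrix P Q R T\<close> is the matrix with block rows \<open>[P, Q]\<close> and \<open>[R, T]\<close>.\<close>

definition block_matrix ::
  "real^'c^'r \<Rightarrow> real^'d^'r \<Rightarrow> real^'c^'s \<Rightarrow> real^'d^'s \<Rightarrow> real^('c + 'd)^('r + 's)" where
  "block_matrix P Q R T = (\<chi> i j.
     case i of
       Inl r \<Rightarrow> (case j of Inl c \<Rightarrow> P $ r $ c | Inr d \<Rightarrow> Q $ r $ d)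
     | Inr s \<Rightarrow> (case j of Inl c \<Rightarrow> R $ s $ c | Inr d \<Rightarrow> T $ s $ d))"

definition eigenvalues :: "real^'n^'n \<Rightarrow> real set" where
  "eigenvalues M = {\<mu>. \<exists>v. v \<noteq> 0 \<and> M *v v = \<mu> *\<^sub>R v}"

text \<open>
  Singular values are the square roots of the eigenvalues of \<open>A A\<^sup>T\<close>, one for each row
  of \<open>A\<close> when counted with multiplicity. This is the usual convention for matrices with at most
  as many rows as columns; \<open>0\<close> is a singular value whenever the rows are linearly dependent.
\<close>

definition singular_values :: "real^'c^'r \<Rightarrow> real set" where
  "singular_values A = sqrt ` eigenvalues (A ** transpose A)"

definition sigma_min :: "real^'c^'r \<Rightarrow> real" where
  "sigma_min A = Min (singular_values A)"

end

theory Submission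
  imports Defs
begin

text \<open>The rows of \<open>B\<close> have disjoint supports, so the Gram matrix
  \<open>B ** transpose B\<close> is diagonal with entries the squared norms of the
  \<open>m i\<close> (\<open>block_diag_rows_gram\<close>). Its eigenvalues are these entries, which
  gives \<open>sigma_min\<close>; they are nonzero, so \<open>transpose B\<close> is injective and
  \<open>B\<close> has full row rank. For unit \<open>m i\<close> the Gram matrix is the identity,
  and \<open>inf_sup_constant_coisometry\<close> applies.

  Invertibility comes from quadratic forms. Skew parts contribute nothing, so a saddle-point matrix
  has the form of its leading block alone (\<open>inner_saddle_point\<close>). With
  \<open>H + S\<close> there, a kernel vector has zero upper part, and injectivity of
  \<open>transpose B\<close> kills the lower part. The two shifted matrices have positive definite
  forms (\<open>invertible_semidefinite_shift\<close>).\<close>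

lemma invertible_if_trivial_kernel:
  fixes A :: "real^'n^'n"
  assumes "\<And>x. A *v x = 0 \<Longrightarrow> x = 0"
  shows "invertible A"
  using assms matrix_left_invertible_ker[of A] invertible_left_inverse[of A] by blast

lemma invertible_if_pos_def:
  fixes A :: "real^'n^'n"
  assumes "\<And>x. x \<noteq> 0 \<Longrightarrow> 0 < x \<bullet> (A *v x)"
  shows "invertible A"
  by (rule invertible_if_trivial_kernel) (metis assms inner_zero_right less_irrefl)

lemma scaleR_mat_1_mult_vec: "(c *\<^sub>R mat 1) *v x = c *\<^sub>R (x :: real^'n)"
  by (simp add: scaleR_matrix_vector_assoc[symmetric])

lemma inner_transpose_mult_vec: "(x :: real^'c) \<bullet> (transpose A *v y) = (A *v x) \<bullet> (y :: real^'r)"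
  using dot_lmul_matrix[of y A x] by (simp add: inner_commute)

text \<open>Moving \<open>A\<close> across the inner product flips the sign, so the value equals its
  own negative.\<close>

lemma inner_skew_mult_vec:
  fixes A :: "real^'n^'n"
  assumes "transpose A = - A"
  shows "x \<bullet> (A *v x) = 0"
proof -
  have "x \<bullet> ((- A) *v x) = (A *v x) \<bullet> x"
    using inner_transpose_mult_vec[of x A x] assms by simp
  moreover have "(- A) *v x = - (A *v x)"
    using matrix_vector_mult_diff_rdistrib[of 0 A x] by simp
  ultimately show ?thesis
    by (simp add: inner_commute)
qed

definition upper_part :: "real^('c::finite + 'd::finite) \<Rightarrow> real^'c" where
  "upper_part x = (\<chi> i. x $ Inl i)"

definition lower_part :: "real^('c::finite + 'd::finite) \<Rightarrow> real^'d" where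
  "lower_part x = (\<chi> i. x $ Inr i)"

lemma sum_UNIV_Plus:
  "(\<Sum>i\<in>UNIV. f i) = (\<Sum>i\<in>UNIV. f (Inl i)) + (\<Sum>j\<in>UNIV. f (Inr j))"
  for f :: "'c::finite + 'd::finite \<Rightarrow> 'a::comm_monoid_add"
  using sum.Plus[of "UNIV :: 'c set" "UNIV :: 'd set" f] by simp

lemma inner_parts:
  "x \<bullet> y = upper_part x \<bullet> upper_part y + lower_part x \<bullet> lower_part y"
  by (simp add: inner_vec_def upper_part_def lower_part_def sum_UNIV_Plus)

lemma eq_0_iff_parts: "x = 0 \<longleftrightarrow> upper_part x = 0 \<and> lower_part x = 0"
  using inner_parts[of x x] by (metis add.right_neutral inner_eq_zero_iff add_nonneg_eq_0_iff inner_ge_zero)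

lemma upper_part_block_matrix:
  "upper_part (block_matrix P Q R T *v x) = P *v upper_part x + Q *v lower_part x"
  by (simp add: vec_eq_iff upper_part_def lower_part_def block_matrix_def
      matrix_vector_mult_def sum_UNIV_Plus)

lemma lower_part_block_matrix:
  "lower_part (block_matrix P Q R T *v x) = R *v upper_part x + T *v lower_part x"
  by (simp add: vec_eq_iff upper_part_def lower_part_def block_matrix_def
      matrix_vector_mult_def sum_UNIV_Plus)

text \<open>The off-diagonal blocks are skew to each other and cancel in the quadratic form.\<close>

lemma inner_saddle_point:
  fixes K :: "real^'c^'c" and B :: "real^'c^'d"
  shows "x \<bullet> (block_matrix K (transpose B) (- B) 0 *v x) = upper_part x \<bullet> (K *v upper_part x)"
proof -
  have "(- B) *v upper_part x = - (B *v upper_part x)"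
    using matrix_vector_mult_diff_rdistrib[of 0 B "upper_part x"] by simp
  then show ?thesis
    by (simp add: inner_parts upper_part_block_matrix lower_part_block_matrix inner_add_right
        inner_transpose_mult_vec inner_commute del: transpose_matrix_vector)
qed

text \<open>Pairing the kernel equation with \<open>x\<close> itself leaves only the form of
  \<open>K\<close>, which forces the upper part to vanish. The first block row then reads
  \<open>transpose B *v lower_part x = 0\<close>.\<close>

lemma invertible_saddle_point:
  fixes K :: "real^'c^'c" and B :: "real^'c^'d"
  assumes K: "\<And>u. u \<noteq> 0 \<Longrightarrow> 0 < u \<bullet> (K *v u)"
    and B: "\<And>q. transpose B *v q = 0 \<Longrightarrow> q = 0"
  shows "invertible (block_matrix K (transpose B) (- B) 0)"
proof (rule invertible_if_trivial_kernel)
  fix x assume x: "block_matrix K (transpose B) (- B) 0 *v x = 0"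
  then have u: "upper_part x = 0"
    using K[of "upper_part x"] inner_saddle_point[of x K B] by fastforce
  have "transpose B *v lower_part x = upper_part (block_matrix K (transpose B) (- B) 0 *v x)"
    by (simp add: upper_part_block_matrix u)
  also have "\<dots> = 0"
    by (metis x eq_0_iff_parts)
  finally show "x = 0"
    using u B eq_0_iff_parts by blast
qed

text \<open>The shift adds \<open>c * (x \<bullet> x)\<close> to a nonnegative form. This covers
  both shifted matrices: one form is that of \<open>H\<close> on the upper part, the other is
  identically zero.\<close>

lemma invertible_semidefinite_shift:
  fixes A :: "real^'n^'n"
  assumes A: "\<And>x. 0 \<le> x \<bullet> (A *v x)" and c: "c > 0"
  shows "invertible (A + c *\<^sub>R mat 1)"
proof (rule invertible_if_pos_def)
  fix x :: "real^'n" assume "x \<noteq> 0"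
  then have "0 < c * (x \<bullet> x)"
    using c by simp
  then show "0 < x \<bullet> ((A + c *\<^sub>R mat 1) *v x)"
    using A[of x]
    by (simp add: matrix_vector_mult_add_rdistrib scaleR_mat_1_mult_vec inner_add_right)
qed

lemma diagonal_matrix_mult_vec: "(diagonal_matrix d *v x) $ i = d i * x $ i"
  by (simp add: diagonal_matrix_def matrix_vector_mult_def if_distrib[of "\<lambda>a. a * _"] cong: if_cong)

lemma eigenvalues_diagonal_matrix: "eigenvalues (diagonal_matrix d) = range d"
proof (intro equalityI subsetI)
  fix \<mu> assume "\<mu> \<in> eigenvalues (diagonal_matrix d)"
  then obtain v where v: "v \<noteq> 0" "diagonal_matrix d *v v = \<mu> *\<^sub>R v"
    by (auto simp: eigenvalues_def)
  from v(1) obtain i where "v $ i \<noteq> 0"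
    by (auto simp: vec_eq_iff)
  moreover have "d i * v $ i = \<mu> * v $ i"
    by (metis v(2) diagonal_matrix_mult_vec vector_scaleR_component real_scaleR_def)
  ultimately have "\<mu> = d i"
    by simp
  then show "\<mu> \<in> range d"
    by simp
next
  fix \<mu> assume "\<mu> \<in> range d"
  then obtain i where i: "\<mu> = d i"
    by auto
  have "axis i (1::real) \<noteq> 0" "diagonal_matrix d *v axis i 1 = \<mu> *\<^sub>R axis i 1"
    by (auto simp: vec_eq_iff diagonal_matrix_mult_vec i axis_def)
  then show "\<mu> \<in> eigenvalues (diagonal_matrix d)"
    unfolding eigenvalues_def by blast
qed

lemma sigma_min_if_gram_diagonal:
  assumes "A ** transpose A = diagonal_matrix d"
  shows "sigma_min A = (MIN i. sqrt (d i))"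
  by (simp add: sigma_min_def singular_values_def assms eigenvalues_diagonal_matrix image_image)

text \<open>Distinct rows live on distinct groups of coordinates and are therefore orthogonal; a row
  paired with itself gives \<open>m i \<bullet> m i\<close>.\<close>

lemma block_diag_rows_gram:
  fixes m :: "'n::finite \<Rightarrow> real^'k::finite"
  shows "block_diag_rows m ** transpose (block_diag_rows m) = diagonal_matrix (\<lambda>i. (norm (m i))\<^sup>2)"
proof -
  have "(\<Sum>p\<in>UNIV. (if fst p = i then m i $ snd p else 0) * (if fst p = j then m j $ snd p else 0))
      = (if i = j then m i \<bullet> m i else 0)" for i j
  proof -
    have "(\<Sum>p\<in>UNIV. (if fst p = i then m i $ snd p else 0) * (if fst p = j then m j $ snd p else 0))
      = (\<Sum>a\<in>UNIV. \<Sum>k\<in>UNIV. (if a = i then m i $ k else 0) * (if a = j then m j $ k else 0))"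
      by (simp add: sum.cartesian_product case_prod_unfold)
    \<comment> \<open>Group \<open>a\<close> contributes only when \<open>a = i\<close> and
      \<open>a = j\<close>.\<close>
    also have "\<dots> = (\<Sum>a\<in>UNIV. if a = i then (if i = j then m i \<bullet> m i else 0) else 0)"
      by (rule sum.cong) (auto simp: inner_vec_def)
    finally show ?thesis
      by simp
  qed
  then show ?thesis
    by (simp add: vec_eq_iff block_diag_rows_def diagonal_matrix_def matrix_matrix_mult_def
        transpose_def power2_norm_eq_inner)
qed

text \<open>Applying \<open>A\<close> to the hypothesis on \<open>q\<close> gives
  \<open>d i * q $ i = 0\<close> in each coordinate.\<close>

lemma transpose_mult_vec_eq_0_if_gram_diagonal:
  fixes A :: "real^'c^'r"
  assumes "A ** transpose A = diagonal_matrix d" "\<And>i. d i \<noteq> 0" "transpose A *v q = 0"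
  shows "q = 0"
proof -
  have "diagonal_matrix d *v q = 0"
    using assms(1,3) by (metis matrix_vector_mul_assoc matrix_vector_mult_0_right)
  then show ?thesis
    using assms(2) diagonal_matrix_mult_vec[of d q] by (simp add: vec_eq_iff)
qed

text \<open>For fixed \<open>q\<close> the supremum is attained at \<open>v = A\<^sup>T q\<close>, which has the norm of \<open>q\<close>.\<close>

lemma inf_sup_constant_coisometry:
  fixes A :: "real^'c^'r"
  assumes A: "A ** transpose A = mat 1"
  shows "(INF q\<in>{q. q \<noteq> 0}. SUP v\<in>{v. v \<noteq> 0}.
    ereal ((q \<bullet> (A *v v)) / (norm q * norm v))) = 1"
proof -
  have "(SUP v\<in>{v. v \<noteq> 0}. ereal ((q \<bullet> (A *v v)) / (norm q * norm v))) = 1"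
    if q: "q \<noteq> 0" for q
  proof (rule antisym)
    define w where "w = transpose A *v q"
    have Aw: "A *v w = q"
      by (simp add: w_def matrix_vector_mul_assoc A del: transpose_matrix_vector)
    \<comment> \<open>Since \<open>w\<close> represents the functional in the numerator,
      Cauchy-Schwarz together with \<open>norm w = norm q\<close> bounds every quotient by
      1.\<close>
    have inner_w: "q \<bullet> (A *v v) = w \<bullet> v" for v
      using inner_transpose_mult_vec[of v A q] by (simp add: w_def inner_commute)
    have norm_w: "norm w = norm q"
      using inner_w[of w] by (simp add: Aw norm_eq_sqrt_inner)
    show "(SUP v\<in>{v. v \<noteq> 0}. ereal ((q \<bullet> (A *v v)) / (norm q * norm v))) \<le> 1"
      using q norm_cauchy_schwarz[of w] by (intro SUP_least) (simp add: inner_w norm_w)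
    have "w \<noteq> 0"
      using norm_w q by auto
    moreover have "ereal ((q \<bullet> (A *v w)) / (norm q * norm w)) = 1"
      using q by (simp add: Aw norm_w power2_norm_eq_inner[symmetric] power2_eq_square)
    ultimately show "1 \<le> (SUP v\<in>{v. v \<noteq> 0}. ereal ((q \<bullet> (A *v v)) / (norm q * norm v)))"
      by (intro SUP_upper2[of w]) auto
  qed
  \<comment> \<open>The infimum of a constant is that constant only over a nonempty set;
    \<open>undefined\<close> serves as an arbitrary index.\<close>
  moreover have "axis undefined 1 \<in> {q :: real^'r. q \<noteq> 0}"
    by (simp add: axis_eq_0_iff)
  ultimately show ?thesis
    by (subst INF_eq_const[where x = 1]) auto
qed

theorem proposition1:
  fixes H S :: "real^('n::finite \<times> 3)^('n \<times> 3)"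
    and m :: "'n \<Rightarrow> real^3"
    and B :: "real^('n \<times> 3)^'n"
  assumes H_sym: "transpose H = H"
    and H_pos_def: "\<And>x. x \<noteq> 0 \<Longrightarrow> 0 < x \<bullet> (H *v x)"
    and S_skew: "transpose S = - S"
    and m_nonzero: "\<And>i. m i \<noteq> 0"
    and B: "B = block_diag_rows m"
  shows "rank B = CARD('n)
    \<and> B ** transpose B = diagonal_matrix (\<lambda>i. (norm (m i))\<^sup>2)
    \<and> sigma_min B = (MIN i. norm (m i))
    \<and> ((\<forall>i. norm (m i) = 1) \<longrightarrow>
         (INF q\<in>{q :: real^'n. q \<noteq> 0}. SUP v\<in>{v :: real^('n \<times> 3). v \<noteq> 0}.
            ereal ((q \<bullet> (B *v v)) / (norm q * norm v))) = 1)
    \<and> invertible (block_matrix (H + S) (transpose B) (- B) 0)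
    \<and> (\<forall>c :: real. c > 0 \<longrightarrow>
         invertible (block_matrix H 0 0 (0 :: real^'n^'n) + c *\<^sub>R mat 1)
       \<and> invertible (block_matrix S (transpose B) (- B) 0 + c *\<^sub>R mat 1))"
proof (intro conjI allI impI)
  show gram: "B ** transpose B = diagonal_matrix (\<lambda>i. (norm (m i))\<^sup>2)"
    by (simp add: B block_diag_rows_gram)
  have ker: "q = 0" if "transpose B *v q = 0" for q
    by (rule transpose_mult_vec_eq_0_if_gram_diagonal[OF gram _ that]) (simp add: m_nonzero)
  then have "inj ((*v) (transpose B))"
    by (simp add: linear_injective_0)
  \<comment> \<open>Injectivity of \<open>transpose B\<close> is full column rank, and transposition
    preserves rank.\<close>
  then show "rank B = CARD('n)"
    using full_rank_injective[of "transpose B"] by (simp add: rank_transpose)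
  show "sigma_min B = (MIN i. norm (m i))"
    by (simp add: sigma_min_if_gram_diagonal[OF gram])
  show "(INF q\<in>{q :: real^'n. q \<noteq> 0}. SUP v\<in>{v :: real^('n \<times> 3). v \<noteq> 0}.
      ereal ((q \<bullet> (B *v v)) / (norm q * norm v))) = 1" if "\<forall>i. norm (m i) = 1"
    by (rule inf_sup_constant_coisometry) (simp add: gram that diagonal_matrix_def mat_def)
  \<comment> \<open>The form of \<open>H + S\<close> is that of \<open>H\<close>, because the skew
    part \<open>S\<close> drops out.\<close>
  show "invertible (block_matrix (H + S) (transpose B) (- B) 0)"
    using ker by (intro invertible_saddle_point)
      (simp_all add: matrix_vector_mult_add_rdistrib inner_add_right inner_skew_mult_vec[OF S_skew]
        H_pos_def)
  fix c :: real assume "c > 0"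
  have "0 \<le> u \<bullet> (H *v u)" for u
    using H_pos_def[of u] by (cases "u = 0") auto
  then show "invertible (block_matrix H 0 0 (0 :: real^'n^'n) + c *\<^sub>R mat 1)"
    using \<open>c > 0\<close> by (intro invertible_semidefinite_shift)
      (simp_all add: inner_parts upper_part_block_matrix lower_part_block_matrix)
  show "invertible (block_matrix S (transpose B) (- B) 0 + c *\<^sub>R mat 1)"
    using \<open>c > 0\<close> by (intro invertible_semidefinite_shift)
      (simp_all add: inner_saddle_point inner_skew_mult_vec[OF S_skew])
qed

end
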